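(* Let $f \colon \mathbb{R}^n \to \mathbb{R}$ be $L$-smooth and $\mu$-strongly convex with respect to the given inner product, with $0 < \mu \le L$, and let $x^*$ be its unique global minimizer. Let $x, d \in \mathbb{R}^n$ be such that $\nabla f(x) \ne 0$ and \[ \|d - \nabla f(x)\| \le \varepsilon \|\nabla f(x)\| \] for some $\varepsilon \in [0,1)$. Define \[ \bar h = \frac{2}{L(1+\varepsilon) + \mu(1-\varepsilon)}. \] Then for $0 \le h \le \bar h$ the point $x^+ = x - hd$ satisfies \[ f(x^+) - f(x^* ) \le \left(1 - h\mu\left(1 - \frac{\|d-\nabla f(x)\|}{\|\nabla f(x)\|}\right)\right)^2 (f(x) - f(x^* )) \le \left(1 - h\mu(1-\varepsilon)\right)^2 (f(x) - f(x^* )). \] In particular, the step size $h = \bar h$ yields \[ f(x^+) - f(x^* ) \le \left(\frac{\kappa_\varepsilon - 1}{\kappa_\varepsilon + 1}\right)^2 (f(x) - f(x^* )), \qquad \kappa_\varepsilon = \frac{L}{\mu}\left(\frac{1+\varepsilon}{1-\varepsilon}\right). \]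
   Context: $\mathbb{R}^n$ is equipped with an arbitrary fixed inner product $\langle \cdot,\cdot\rangle$ with corresponding norm $\|\cdot\|$, and $\nabla f$ denotes the gradient of the differentiable function $f$ with respect to this inner product. The function $f$ is $L$-smooth if $\|\nabla f(x) - \nabla f(y)\| \le L\|x-y\|$ for all $x,y \in \mathbb{R}^n$, and $\mu$-strongly convex if $f(x) \ge f(y) + \langle \nabla f(y), x-y\rangle + \frac{\mu}{2}\|x-y\|^2$ for all $x,y\in\mathbb{R}^n$. *)

theory Defs
  imports "HOL-Analysis.Analysis"
begin

definition is_inner_product :: "('a::real_vector \<Rightarrow> 'a \<Rightarrow> real) \<Rightarrow> bool" where
  "is_inner_product B \<longleftrightarrow>
     bilinear B \<and> (\<forall>x y. B x y = B y x) \<and> (\<forall>x. x \<noteq> 0 \<longrightarrow> B x x > 0)"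

definition ip_norm :: "('a::real_vector \<Rightarrow> 'a \<Rightarrow> real) \<Rightarrow> 'a \<Rightarrow> real" where
  "ip_norm B x = sqrt (B x x)"

text \<open>The gradient with respect to \<open>B\<close> is the vector representing the Frechet derivative
  through \<open>B\<close>. Differentiability itself may be taken with respect to the library norm, since
  all norms on a finite-dimensional space are equivalent.\<close>

definition ip_gradient ::
    "('a::real_normed_vector \<Rightarrow> 'a \<Rightarrow> real) \<Rightarrow> ('a \<Rightarrow> real) \<Rightarrow> 'a \<Rightarrow> 'a" where
  "ip_gradient B f x = (THE g. (f has_derivative (\<lambda>v. B g v)) (at x))"

lemma ex1_ip_gradient:
  fixes B :: "'a::euclidean_space \<Rightarrow> 'a \<Rightarrow> real"
  assumes B: "is_inner_product B" and f: "f differentiable (at x)"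
  shows "\<exists>!g. (f has_derivative (\<lambda>v. B g v)) (at x)"
proof -
  have bil: "bilinear B" and pos: "\<And>x. x \<noteq> 0 \<Longrightarrow> B x x > 0"
    using B by (auto simp: is_inner_product_def)
  have lin1: "linear (\<lambda>v. B v w)" and lin2: "linear (\<lambda>v. B w v)" for w
    using bil by (auto simp: bilinear_def)
  have inj0: "g = g'" if "\<And>v. B g v = B g' v" for g g'
  proof (rule ccontr)
    assume "g \<noteq> g'"
    then have "B (g - g') (g - g') > 0" using pos by simp
    moreover have "B (g - g') (g - g') = 0"
      using that by (simp add: linear_diff[OF lin1])
    ultimately show False by simp
  qed
  define A where "A g = (\<Sum>b\<in>Basis. B g b *\<^sub>R b)" for g
  have lin_expand: "D v = (\<Sum>b\<in>Basis. D b *\<^sub>R b) \<bullet> v"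
    if "linear D" for D :: "'a \<Rightarrow> real" and v
  proof -
    have "D v = D (\<Sum>b\<in>Basis. (v \<bullet> b) *\<^sub>R b)" by (simp add: euclidean_representation)
    also have "\<dots> = (\<Sum>b\<in>Basis. (v \<bullet> b) * D b)"
      using that by (simp add: linear_sum linear_cmul)
    finally show ?thesis by (simp add: inner_sum_left mult.commute inner_commute[of v])
  qed
  have BA: "B g v = A g \<bullet> v" for g v
    unfolding A_def by (rule lin_expand[OF lin2])
  have "linear A"
    unfolding A_def
    by (rule linearI) (simp_all add: linear_add[OF lin1] linear_cmul[OF lin1]
        scaleR_add_left sum.distrib scaleR_sum_right)
  moreover have "inj A"
    by (rule injI, rule inj0) (simp add: BA)
  ultimately have "surj A" by (simp add: linear_injective_imp_surjective)
  obtain D where D: "(f has_derivative D) (at x)"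
    using f by (auto simp: differentiable_def)
  obtain g where g: "A g = (\<Sum>b\<in>Basis. D b *\<^sub>R b)" using \<open>surj A\<close> by (metis surjD)
  have "(\<lambda>v. B g v) = D"
    by (rule ext) (simp add: BA g lin_expand[OF has_derivative_linear[OF D], symmetric])
  then have "(f has_derivative (\<lambda>v. B g v)) (at x)" using D by simp
  moreover have "g' = g" if "(f has_derivative (\<lambda>v. B g' v)) (at x)" for g'
    using has_derivative_unique[OF that \<open>(f has_derivative (\<lambda>v. B g v)) (at x)\<close>]
    by (intro inj0) (simp add: fun_eq_iff)
  ultimately show ?thesis by blast
qed

definition L_smooth ::
    "('a::real_normed_vector \<Rightarrow> 'a \<Rightarrow> real) \<Rightarrow> real \<Rightarrow> ('a \<Rightarrow> real) \<Rightarrow> bool" where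
  "L_smooth B L f \<longleftrightarrow>
     (\<forall>x. f differentiable (at x)) \<and>
     (\<forall>x y. ip_norm B (ip_gradient B f x - ip_gradient B f y) \<le> L * ip_norm B (x - y))"

definition strongly_convex ::
    "('a::real_normed_vector \<Rightarrow> 'a \<Rightarrow> real) \<Rightarrow> real \<Rightarrow> ('a \<Rightarrow> real) \<Rightarrow> bool" where
  "strongly_convex B \<mu> f \<longleftrightarrow>
     (\<forall>x. f differentiable (at x)) \<and>
     (\<forall>x y. f x \<ge> f y + B (ip_gradient B f y) (x - y) + \<mu> / 2 * (ip_norm B (x - y))\<^sup>2)"

end

theory Submission
  imports Defs
begin

text \<open>
  Write \<open>g\<close> for the gradient of \<open>f\<close> and \<open>\<delta> = \<parallel>d - g x\<parallel> / \<parallel>g x\<parallel>\<close>.  The idea is that the inexact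
  direction \<open>d\<close> is the \<^emph>\<open>exact\<close> gradient at \<open>x\<close> with respect to another inner product.  The vectors
  \<open>g x\<close> and \<open>(d - g x) / \<delta>\<close> have the same norm, so some symmetric involution \<open>R\<close>, a Householder
  reflection unless they agree, exchanges them (\<open>ex_symmetric_involution\<close>), and
  \<open>M = I + \<delta> R\<close> maps \<open>g x\<close> to \<open>d\<close>.  Since \<open>R\<close> is symmetric with
  \<open>R\<^sup>2 = I\<close>, the map \<open>M\<close> has eigenvalues in \<open>{1 - \<delta>, 1 + \<delta>}\<close> and inverse
  \<open>(I - \<delta> R) / (1 - \<delta>\<^sup>2)\<close>.  In the inner product \<open>Q u v = B (M\<^sup>-\<^sup>1 u) v\<close> the gradient field of \<open>f\<close>
  is \<open>M \<circ> g\<close>, and the quadratic upper and lower bounds that smoothness and strong convexity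
  give for \<open>f\<close> hold with the constants \<open>L (1 + \<delta>)\<close> and \<open>\<mu> (1 - \<delta>)\<close>.

  For \<open>\<delta> = 0\<close> the direction is exact already, with \<open>M = I\<close>.

  What remains is the sharp rate of one exact gradient step (\<open>gradient_step_contraction\<close>): with
  constants \<open>m \<le> L\<close> and \<open>h \<le> 2 / (L + m)\<close>, the gap \<open>f x - f s\<close> contracts by \<open>\<rho>\<^sup>2\<close>, where
  \<open>\<rho> = 1 - h m\<close>.  Subtracting \<open>m / 2 \<parallel>y - s\<parallel>\<^sup>2\<close> from \<open>f y\<close> leaves a convex function with smoothness
  constant \<open>L - m\<close>, for which the cocoercivity inequality is available between any two points.  Use it
  for the pairs \<open>(x, x\<^sup>+)\<close>, \<open>(s, x)\<close> and \<open>(s, x\<^sup>+)\<close> with weights \<open>\<rho>\<close>, \<open>\<rho> (1 - \<rho>)\<close> and \<open>1 - \<rho>\<close>.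
  These weights are forced: the function values have to combine to
  \<open>\<rho>\<^sup>2 f x + (1 - \<rho>\<^sup>2) f s - f x\<^sup>+\<close>, and since \<open>\<parallel>x - s\<parallel>\<^sup>2\<close> drops out, the product of
  the gradient at \<open>x\<^sup>+\<close> with \<open>x - s\<close> has to cancel.  Then all terms that contain \<open>x - s\<close> cancel, and the
  rest is a quadratic form in the two gradients which is nonnegative because \<open>h (L + m) \<le> 2\<close>.

  Since \<open>L (1 + t) + \<mu> (1 - t)\<close> increases with \<open>t\<close>, a step that is admissible for \<open>\<epsilon>\<close> is
  admissible for \<open>\<delta> \<le> \<epsilon>\<close>.
\<close>

section \<open>Inner products\<close>

lemma is_inner_product_bilinear: "is_inner_product B \<Longrightarrow> bilinear B"
  by (simp add: is_inner_product_def)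

lemma is_inner_product_commute: "is_inner_product B \<Longrightarrow> B x y = B y x"
  by (simp add: is_inner_product_def)

lemma is_inner_product_nonneg:
  assumes "is_inner_product B"
  shows "0 \<le> B x x"
  using assms bilinear_lzero[OF is_inner_product_bilinear[OF assms], of 0]
  by (cases "x = 0") (auto simp: is_inner_product_def less_imp_le)

lemma is_inner_product_eq_0_iff:
  assumes "is_inner_product B"
  shows "B x x = 0 \<longleftrightarrow> x = 0"
  using assms bilinear_lzero[OF is_inner_product_bilinear[OF assms], of 0]
  by (metis is_inner_product_def less_irrefl)

lemmas bilinear_expand =
  bilinear_ladd bilinear_radd bilinear_lsub bilinear_rsub bilinear_lmul bilinear_rmul
  bilinear_lneg bilinear_rneg bilinear_lzero bilinear_rzero

lemma ip_norm_square:
  assumes "is_inner_product B"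
  shows "(ip_norm B x)\<^sup>2 = B x x"
  using is_inner_product_nonneg[OF assms] by (simp add: ip_norm_def)

lemma ip_norm_nonneg:
  assumes "is_inner_product B"
  shows "0 \<le> ip_norm B x"
  using is_inner_product_nonneg[OF assms] by (simp add: ip_norm_def)

lemma ip_norm_pos:
  assumes "is_inner_product B" "x \<noteq> 0"
  shows "0 < ip_norm B x"
  using assms by (simp add: ip_norm_def is_inner_product_def)

text \<open>
  This weak form of the Cauchy--Schwarz inequality is the nonnegativity of \<open>\<parallel>u - k v\<parallel>\<^sup>2\<close>.
\<close>

lemma inner_product_le_of_norm_le:
  assumes B: "is_inner_product B" and k: "0 < k" and le: "ip_norm B u \<le> k * ip_norm B v"
  shows "B u v \<le> k * B v v"
proof -
  note b = bilinear_expand[OF is_inner_product_bilinear[OF B]]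
  have "(ip_norm B u)\<^sup>2 \<le> (k * ip_norm B v)\<^sup>2"
    using le ip_norm_nonneg[OF B] by (rule power_mono)
  then have "B u u \<le> k\<^sup>2 * B v v"
    by (simp add: power_mult_distrib ip_norm_square[OF B])
  moreover have "0 \<le> B (u - k *\<^sub>R v) (u - k *\<^sub>R v)"
    by (rule is_inner_product_nonneg[OF B])
  then have "0 \<le> B u u - 2 * (k * B u v) + k\<^sup>2 * B v v"
    by (simp add: b is_inner_product_commute[OF B, of v u] algebra_simps power2_eq_square)
  ultimately have "k * B u v \<le> k * (k * B v v)"
    by (simp add: power2_eq_square)
  then show ?thesis using k by simp
qed

text \<open>
  For \<open>u \<noteq> v\<close> this is the Householder reflection in the hyperplane orthogonal to \<open>u - v\<close>.
\<close>

lemma ex_symmetric_involution: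
  assumes B: "is_inner_product B" and eq: "B u u = B v v"
  shows "\<exists>R. linear R \<and> (\<forall>x y. B (R x) y = B x (R y)) \<and> (\<forall>x. R (R x) = x) \<and> R u = v"
proof (cases "u = v")
  case True
  then show ?thesis by (intro exI[of _ "\<lambda>x. x"]) (simp add: linear_ident)
next
  case False
  note b = bilinear_expand[OF is_inner_product_bilinear[OF B]]
  define w where "w = u - v"
  define c where "c = B w w"
  define R where "R x = x - (2 * B w x / c) *\<^sub>R w" for x
  have c: "c \<noteq> 0"
    using False is_inner_product_eq_0_iff[OF B] by (simp add: c_def w_def)
  have "linear R"
    by (rule linearI) (simp_all add: R_def b algebra_simps add_divide_distrib)
  moreover have "B (R x) y = B x (R y)" for x y
    by (simp add: R_def b is_inner_product_commute[OF B, of x w])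
  moreover have "R (R x) = x" for x
  proof -
    have "B w (R x) = - B w x"
      using c by (simp add: R_def b c_def[symmetric])
    then show ?thesis
      unfolding R_def[of "R x"] by (simp add: R_def)
  qed
  moreover have "R u = v"
  proof -
    have "c = 2 * B w u"
      by (simp add: c_def w_def b eq is_inner_product_commute[OF B, of v u])
    then have "2 * B w u / c = 1" using c by simp
    then show ?thesis by (simp add: R_def w_def)
  qed
  ultimately show ?thesis by blast
qed

text \<open>
  A symmetric involution is an isometry with eigenvalues in \<open>{1, -1}\<close>.  Expanding the squares of
  \<open>v - R v\<close> and \<open>v + R v\<close> gives the resulting bound without spectral theory.
\<close>

lemma involution_quadratic_bound:
  assumes B: "is_inner_product B"
    and sym: "\<And>x y. B (R x) y = B x (R y)" and inv: "\<And>x. R (R x) = x"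
  shows "\<bar>B (R v) v\<bar> \<le> B v v"
proof -
  note b = bilinear_expand[OF is_inner_product_bilinear[OF B]]
  have iso: "B (R v) (R v) = B v v" by (simp add: sym inv)
  have "0 \<le> B (v - R v) (v - R v)" "0 \<le> B (v + R v) (v + R v)"
    by (rule is_inner_product_nonneg[OF B])+
  then show ?thesis
    by (simp add: b iso is_inner_product_commute[OF B, of v "R v"])
qed

section \<open>Quadratic bounds from smoothness and strong convexity\<close>

lemma has_derivative_ip_gradient:
  fixes B :: "'a::euclidean_space \<Rightarrow> 'a \<Rightarrow> real"
  assumes "is_inner_product B" "f differentiable (at x)"
  shows "(f has_derivative (\<lambda>v. B (ip_gradient B f x) v)) (at x)"
  unfolding ip_gradient_def using theI'[OF ex1_ip_gradient[OF assms]] .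

text \<open>
  The descent lemma: along the segment from \<open>z\<close> to \<open>y\<close>, the difference \<open>\<psi>\<close> between \<open>f\<close> and the
  claimed upper bound has nonpositive derivative.
\<close>

lemma L_smooth_quadratic_upper_bound:
  fixes B :: "'a::euclidean_space \<Rightarrow> 'a \<Rightarrow> real"
  assumes B: "is_inner_product B" and L: "0 < L" and f: "L_smooth B L f"
  shows "f y \<le> f z + B (ip_gradient B f z) (y - z) + L / 2 * B (y - z) (y - z)"
proof -
  note b = bilinear_expand[OF is_inner_product_bilinear[OF B]]
  define g where "g = ip_gradient B f"
  define v where "v = y - z"
  define \<psi> where "\<psi> t = f (z + t *\<^sub>R v) - t * B (g z) v - L / 2 * t\<^sup>2 * B v v" for t
  define \<psi>' where "\<psi>' t = B (g (z + t *\<^sub>R v)) v - B (g z) v - L * t * B v v" for t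
  have deriv: "(\<psi> has_real_derivative \<psi>' t) (at t)" for t
  proof -
    have "f differentiable (at (z + t *\<^sub>R v))" using f by (simp add: L_smooth_def)
    then have "(f has_derivative (\<lambda>u. B (g (z + t *\<^sub>R v)) u)) (at (z + t *\<^sub>R v))"
      unfolding g_def by (rule has_derivative_ip_gradient[OF B])
    moreover have "((\<lambda>t. z + t *\<^sub>R v) has_derivative (\<lambda>s. s *\<^sub>R v)) (at t)"
      by (auto intro!: derivative_eq_intros)
    ultimately have
      "((\<lambda>t. f (z + t *\<^sub>R v)) has_derivative (\<lambda>s. B (g (z + t *\<^sub>R v)) (s *\<^sub>R v))) (at t)"
      by (intro has_derivative_compose[where f = "\<lambda>t. z + t *\<^sub>R v" and g = f])
    then have "((\<lambda>t. f (z + t *\<^sub>R v)) has_real_derivative B (g (z + t *\<^sub>R v)) v) (at t)"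
      by (simp add: has_field_derivative_def b mult_commute_abs)
    then show ?thesis
      unfolding \<psi>_def \<psi>'_def
      by (auto intro!: derivative_eq_intros simp: power2_eq_square algebra_simps)
  qed
  have neg: "\<psi>' t \<le> 0" if "0 \<le> t" for t
  proof (cases "t = 0")
    case True
    then show ?thesis by (simp add: \<psi>'_def)
  next
    case False
    with that have t: "0 < t" by simp
    have "ip_norm B (g (z + t *\<^sub>R v) - g z) \<le> L * ip_norm B ((z + t *\<^sub>R v) - z)"
      using f unfolding L_smooth_def g_def by blast
    also have "\<dots> = (L * t) * ip_norm B v"
      using t by (simp add: ip_norm_def b real_sqrt_mult)
    finally have "B (g (z + t *\<^sub>R v) - g z) v \<le> (L * t) * B v v"
      using L t by (intro inner_product_le_of_norm_le[OF B]) auto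
    then show ?thesis by (simp add: \<psi>'_def b)
  qed
  have "\<psi> 1 \<le> \<psi> 0"
    using deriv neg by (intro DERIV_nonpos_imp_nonincreasing[of 0 1 \<psi>]) auto
  then show ?thesis by (simp add: \<psi>_def v_def g_def)
qed

lemma ip_gradient_eq_0_at_minimum:
  fixes B :: "'a::euclidean_space \<Rightarrow> 'a \<Rightarrow> real"
  assumes B: "is_inner_product B" and f: "f differentiable (at s)" and min: "\<And>y. f s \<le> f y"
  shows "ip_gradient B f s = 0"
proof -
  have "(\<lambda>v. B (ip_gradient B f s) v) = (\<lambda>v. 0)"
    using has_derivative_local_min[OF has_derivative_ip_gradient[OF B f]] min
    by (simp add: eventually_at_filter)
  then show ?thesis
    using is_inner_product_eq_0_iff[OF B] by (metis (no_types))
qed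

section \<open>The exact gradient step\<close>

text \<open>
  Only the quadratic upper and lower bounds matter for the analysis of a step, so any map that
  satisfies them with a function stands for the gradient of that function.  This makes the change of inner product a matter of
  algebra.

  Cocoercivity follows from comparing the lower bound at \<open>z\<close> with the upper bound at \<open>y\<close> in the
  point \<open>y - t (g y - g z)\<close>; the best choice is \<open>t = 1 / l\<close>.  The form without division by \<open>l\<close>
  stays true for \<open>l = 0\<close>, when it says that \<open>g\<close> is constant.  This case occurs: it is the one where
  the constants of smoothness and strong convexity agree.
\<close>

lemma cocoercivity:
  assumes Q: "is_inner_product Q" and l: "0 \<le> l"
    and lower: "\<And>y z. \<phi> z + Q (g z) (y - z) \<le> \<phi> y"
    and upper: "\<And>y z. \<phi> y \<le> \<phi> z + Q (g z) (y - z) + l / 2 * Q (y - z) (y - z)"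
  shows "Q (g y - g z) (g y - g z) \<le> 2 * l * (\<phi> y - \<phi> z - Q (g z) (y - z))"
proof -
  note b = bilinear_expand[OF is_inner_product_bilinear[OF Q]]
  define u where "u = g y - g z"
  define D where "D = \<phi> y - \<phi> z - Q (g z) (y - z)"
  have key: "(t - l / 2 * t\<^sup>2) * Q u u \<le> D" for t
  proof -
    have "\<phi> z + Q (g z) ((y - t *\<^sub>R u) - z) \<le> \<phi> (y - t *\<^sub>R u)" by (rule lower)
    also have "\<dots> \<le> \<phi> y + Q (g y) ((y - t *\<^sub>R u) - y)
        + l / 2 * Q ((y - t *\<^sub>R u) - y) ((y - t *\<^sub>R u) - y)" by (rule upper)
    finally have "\<phi> z + Q (g z) (y - z) - t * Q (g z) u
        \<le> \<phi> y - t * Q (g y) u + l / 2 * t\<^sup>2 * Q u u"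
      by (simp add: b algebra_simps power2_eq_square)
    moreover have "Q u u = Q (g y) u - Q (g z) u"
      by (subst u_def) (simp add: b)
    then have "t * Q u u = t * Q (g y) u - t * Q (g z) u"
      by (simp add: right_diff_distrib)
    ultimately show ?thesis
      unfolding D_def left_diff_distrib by linarith
  qed
  have "Q u u \<le> 2 * l * D"
  proof (cases "l = 0")
    case True
    \<comment> \<open>Every step length is admissible, so the nonnegative \<open>Q u u\<close> must vanish.\<close>
    have "Q u u \<le> 0"
    proof (rule ccontr)
      assume "\<not> Q u u \<le> 0"
      then show False using key[of "(D + 1) / Q u u"] True by simp
    qed
    then show ?thesis using True by simp
  next
    case False
    then show ?thesis using key[of "1 / l"] l
      by (simp add: field_simps power2_eq_square)
  qed
  then show ?thesis by (simp add: u_def D_def)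
qed

text \<open>
  In the proof, \<open>\<phi>\<close> is \<open>f\<close> without its strongly convex part, \<open>g\<close> is the gradient of \<open>\<phi>\<close>, and
  \<open>S\<close> is what is left of the weighted sum of the three cocoercivity inequalities.  Bounding \<open>D1\<close>,
  \<open>D2\<close>, \<open>D3\<close> from below by cocoercivity gives
  \<open>2 l S \<ge> \<parallel>q\<parallel>\<^sup>2 + 2 (L h - 1) \<langle>p, q\<rangle> + (1 - m L h\<^sup>2) \<parallel>p\<parallel>\<^sup>2\<close>, which equals
  \<open>\<parallel>q + (L h - 1) p\<parallel>\<^sup>2 + L h (2 - h (L + m)) \<parallel>p\<parallel>\<^sup>2\<close>.
\<close>

lemma gradient_step_contraction:
  assumes Q: "is_inner_product Q" and m: "0 \<le> m" "m \<le> L"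
    and lower: "\<And>y z. f z + Q (G z) (y - z) + m / 2 * Q (y - z) (y - z) \<le> f y"
    and upper: "\<And>y z. f y \<le> f z + Q (G z) (y - z) + L / 2 * Q (y - z) (y - z)"
    and crit: "G s = 0"
    and h: "0 \<le> h" "h * (L + m) \<le> 2"
  shows "f (x - h *\<^sub>R G x) - f s \<le> (1 - h * m)\<^sup>2 * (f x - f s)"
proof -
  note b = bilinear_expand[OF is_inner_product_bilinear[OF Q]]
  note com = is_inner_product_commute[OF Q]
  define l where "l = L - m"
  define \<rho> where "\<rho> = 1 - h * m"
  define \<phi> where "\<phi> y = f y - m / 2 * Q (y - s) (y - s)" for y
  define g where "g y = G y - m *\<^sub>R (y - s)" for y
  have l: "0 \<le> l" using m by (simp add: l_def)
  have "h * (2 * m) \<le> h * (L + m)" using h m by (intro mult_left_mono) auto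
  then have \<rho>: "0 \<le> \<rho>" "\<rho> \<le> 1" using h m by (auto simp: \<rho>_def)
  have shift: "\<phi> y - \<phi> z - Q (g z) (y - z)
      = f y - f z - Q (G z) (y - z) - m / 2 * Q (y - z) (y - z)" for y z
  proof -
    have "Q (u + w) (u + w) = Q u u + 2 * Q w u + Q w w" for u w
      by (simp add: b com[of u w])
    from this[of "y - z" "z - s"]
    have "Q (y - s) (y - s) = Q (y - z) (y - z) + 2 * Q (z - s) (y - z) + Q (z - s) (z - s)"
      by simp
    moreover have "Q (g z) (y - z) = Q (G z) (y - z) - m * Q (z - s) (y - z)"
      by (simp add: g_def b algebra_simps)
    ultimately show ?thesis by (simp add: \<phi>_def algebra_simps)
  qed
  have lower': "\<phi> z + Q (g z) (y - z) \<le> \<phi> y" for y z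
    using shift[of y z] lower[of z y] by linarith
  have upper': "\<phi> y \<le> \<phi> z + Q (g z) (y - z) + l / 2 * Q (y - z) (y - z)" for y z
  proof -
    have "l / 2 * Q (y - z) (y - z) = L / 2 * Q (y - z) (y - z) - m / 2 * Q (y - z) (y - z)"
      by (simp add: l_def field_simps)
    then show ?thesis using shift[of y z] upper[of y z] by linarith
  qed
  note coco = cocoercivity[where Q = Q and g = g and \<phi> = \<phi>, OF Q l lower' upper']
  define x1 where "x1 = x - h *\<^sub>R G x"
  define X where "X = x - s"
  define p where "p = g x"
  define q where "q = g x1"
  have gs: "g s = 0" by (simp add: g_def crit)
  have x1s: "x1 - s = \<rho> *\<^sub>R X - h *\<^sub>R p"
    by (simp add: x1_def \<rho>_def X_def p_def g_def algebra_simps)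
  have xx1: "x - x1 = X - (\<rho> *\<^sub>R X - h *\<^sub>R p)"
    using x1s by (simp add: X_def algebra_simps)
  have sx: "s - x = - X" and sx1: "s - x1 = - (\<rho> *\<^sub>R X - h *\<^sub>R p)"
    using x1s by (simp_all add: X_def algebra_simps)
  define D1 where "D1 = \<phi> x - \<phi> x1 - Q q X + (\<rho> * Q q X - h * Q p q)"
  define D2 where "D2 = \<phi> s - \<phi> x + Q p X"
  define D3 where "D3 = \<phi> s - \<phi> x1 + (\<rho> * Q q X - h * Q p q)"
  have D1: "Q p p - 2 * Q p q + Q q q \<le> 2 * l * D1"
    using coco[of x x1] unfolding xx1
    by (simp add: D1_def p_def[symmetric] q_def[symmetric] b com[of q p] algebra_simps)
  have D2: "Q p p \<le> 2 * l * D2"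
    using coco[of s x] unfolding sx gs
    by (simp add: D2_def p_def[symmetric] b algebra_simps)
  have D3: "Q q q \<le> 2 * l * D3"
    using coco[of s x1] unfolding sx1 gs
    by (simp add: D3_def q_def[symmetric] b com[of q p] algebra_simps)
  have fx: "f x = \<phi> x + m / 2 * Q X X" and fs: "f s = \<phi> s"
    by (simp_all add: \<phi>_def X_def b)
  have fx1: "f x1 = \<phi> x1 + m / 2 * (\<rho>\<^sup>2 * Q X X - 2 * \<rho> * h * Q p X + h\<^sup>2 * Q p p)"
  proof -
    have "Q (x1 - s) (x1 - s) = \<rho>\<^sup>2 * Q X X - 2 * \<rho> * h * Q p X + h\<^sup>2 * Q p p"
      unfolding x1s by (simp add: b com[of X p] algebra_simps power2_eq_square)
    then show ?thesis by (simp add: \<phi>_def)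
  qed
  define S where "S = \<rho> * D1 + \<rho> * (1 - \<rho>) * D2 + (1 - \<rho>) * D3
      + h * Q p q - m * h\<^sup>2 / 2 * Q p p"
  \<comment> \<open>The terms with \<open>Q p X\<close> cancel because \<open>1 - \<rho> = h m\<close>, those with \<open>Q q X\<close> because of the
    weights.\<close>
  have S: "\<rho>\<^sup>2 * (f x - f s) - (f x1 - f s) = S"
    unfolding fx fs fx1 S_def D1_def D2_def D3_def \<rho>_def
    by (simp add: field_simps power2_eq_square)
  have "0 \<le> S"
  proof (cases "l = 0")
    case True
    \<comment> \<open>The bounds force \<open>f y = f s + m / 2 \<parallel>y - s\<parallel>\<^sup>2\<close>, so \<open>\<phi>\<close> is constant.\<close>
    then have "p = 0" "q = 0"
      using D2 D3 is_inner_product_nonneg[OF Q] is_inner_product_eq_0_iff[OF Q]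
      by (metis antisym mult_zero_left mult_zero_right)+
    then show ?thesis
      using lower'[of x1 x] lower'[of x s] lower'[of x1 s] \<rho>
      unfolding xx1 sx sx1 S_def D1_def D2_def D3_def p_def[symmetric] q_def[symmetric]
      by (simp add: b)
  next
    case False
    then have l: "0 < l" using l by simp
    have "0 \<le> Q (q + (L * h - 1) *\<^sub>R p) (q + (L * h - 1) *\<^sub>R p)"
      by (rule is_inner_product_nonneg[OF Q])
    then have sq: "0 \<le> Q q q + 2 * (L * h - 1) * Q p q + (L * h - 1)\<^sup>2 * Q p p"
      by (simp add: b com[of q p] algebra_simps power2_eq_square)
    have "0 \<le> L * h * (2 - h * (L + m)) * Q p p"
      using h m is_inner_product_nonneg[OF Q, of p] by simp
    then have "0 \<le> Q q q + 2 * (L * h - 1) * Q p q + (1 - m * L * h\<^sup>2) * Q p p"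
      using sq by (simp add: algebra_simps power2_eq_square)
    also have "\<dots> = \<rho> * (Q p p - 2 * Q p q + Q q q) + \<rho> * (1 - \<rho>) * Q p p + (1 - \<rho>) * Q q q
        + 2 * l * (h * Q p q - m * h\<^sup>2 / 2 * Q p p)"
      by (simp add: \<rho>_def l_def field_simps power2_eq_square)
    also have "\<dots> \<le> \<rho> * (2 * l * D1) + \<rho> * (1 - \<rho>) * (2 * l * D2) + (1 - \<rho>) * (2 * l * D3)
        + 2 * l * (h * Q p q - m * h\<^sup>2 / 2 * Q p p)"
      using D1 D2 D3 \<rho> l by (intro add_mono mult_left_mono) auto
    also have "\<dots> = 2 * l * S"
      by (simp add: S_def algebra_simps)
    finally show ?thesis using l by (simp add: zero_le_mult_iff)
  qed
  then show ?thesis using S by (simp add: \<rho>_def x1_def)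
qed

section \<open>The inexact step as an exact step\<close>

text \<open>
  The map \<open>M = I + \<delta> R\<close> turns \<open>g x\<close> into \<open>d\<close>, and \<open>N\<close> is its inverse.  The inner product
  \<open>Q y z = B (N y) z\<close> is chosen so that \<open>M \<circ> g\<close> represents the same derivative as \<open>g\<close> does with
  respect to \<open>B\<close>.  The eigenvalues \<open>1 \<plusminus> \<delta>\<close> of \<open>M\<close> compare \<open>Q\<close> with \<open>B\<close> and thus
  change the constants.
\<close>

lemma inexact_gradient_step_contraction:
  assumes B: "is_inner_product B" and m: "0 \<le> m" "m \<le> L"
    and lower: "\<And>y z. f z + B (g z) (y - z) + m / 2 * B (y - z) (y - z) \<le> f y"
    and upper: "\<And>y z. f y \<le> f z + B (g z) (y - z) + L / 2 * B (y - z) (y - z)"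
    and crit: "g s = 0"
    and \<delta>: "0 \<le> \<delta>" "\<delta> < 1"
    and err: "ip_norm B (d - g x) = \<delta> * ip_norm B (g x)"
    and h: "0 \<le> h" "h * (L * (1 + \<delta>) + m * (1 - \<delta>)) \<le> 2"
  shows "f (x - h *\<^sub>R d) - f s \<le> (1 - h * (m * (1 - \<delta>)))\<^sup>2 * (f x - f s)"
proof -
  note b = bilinear_expand[OF is_inner_product_bilinear[OF B]]
  \<comment> \<open>With \<open>\<delta> = 0\<close> the error vanishes, and any vector of the norm of \<open>g x\<close> serves.\<close>
  define v where "v = (if \<delta> = 0 then g x else (1 / \<delta>) *\<^sub>R (d - g x))"
  have sq: "B (d - g x) (d - g x) = \<delta>\<^sup>2 * B (g x) (g x)"
    using err by (simp add: ip_norm_square[OF B, symmetric] power_mult_distrib)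
  have v: "\<delta> *\<^sub>R v = d - g x" and "B (g x) (g x) = B v v"
    using sq is_inner_product_eq_0_iff[OF B, of "d - g x"]
    by (auto simp: v_def b(5,6) power2_eq_square)
  then obtain R where R: "linear R" and sym: "\<And>y z. B (R y) z = B y (R z)"
    and inv: "\<And>y. R (R y) = y" and Rg: "R (g x) = v"
    using ex_symmetric_involution[OF B] by metis
  note lin = linear_add[OF R] linear_diff[OF R] linear_cmul[OF R]
  define c where "c = 1 - \<delta>\<^sup>2"
  have c: "c = (1 + \<delta>) * (1 - \<delta>)" by (simp add: c_def algebra_simps power2_eq_square)
  have c0: "0 < c" using \<delta> by (simp add: c)
  define M where "M y = y + \<delta> *\<^sub>R R y" for y
  define N where "N y = (1 / c) *\<^sub>R (y - \<delta> *\<^sub>R R y)" for y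
  have NM: "N (M y) = y" for y
  proof -
    have "M y - \<delta> *\<^sub>R R (M y) = c *\<^sub>R y"
      by (simp add: M_def lin inv c_def algebra_simps power2_eq_square)
    then show ?thesis using c0 by (simp add: N_def)
  qed
  define Q where "Q y z = B (N y) z" for y z
  have QM: "Q (M y) z = B y z" for y z by (simp add: Q_def NM)
  have cQ: "(1 - \<delta>) * ((1 + \<delta>) * Q y y) = B y y - \<delta> * B (R y) y" for y
  proof -
    have "c * Q y y = B y y - \<delta> * B (R y) y"
      using c0 by (simp add: Q_def N_def b)
    then show ?thesis by (simp add: c mult_ac)
  qed
  have Rb: "\<bar>\<delta> * B (R y) y\<bar> \<le> \<delta> * B y y" for y
    using involution_quadratic_bound[OF B sym inv] \<delta>
    by (simp add: abs_mult mult_left_mono)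
  have Qlow: "B y y \<le> (1 + \<delta>) * Q y y" for y
  proof -
    have "(1 - \<delta>) * B y y \<le> B y y - \<delta> * B (R y) y"
      using Rb[of y] by (simp add: algebra_simps)
    then have "(1 - \<delta>) * B y y \<le> (1 - \<delta>) * ((1 + \<delta>) * Q y y)"
      by (simp add: cQ)
    then show ?thesis using \<delta> by simp
  qed
  have Qup: "(1 - \<delta>) * Q y y \<le> B y y" for y
  proof -
    have "B y y - \<delta> * B (R y) y \<le> (1 + \<delta>) * B y y"
      using Rb[of y] by (simp add: algebra_simps)
    then have "(1 + \<delta>) * ((1 - \<delta>) * Q y y) \<le> (1 + \<delta>) * B y y"
      using cQ[of y] by (simp add: mult.left_commute)
    then show ?thesis using \<delta> by simp
  qed
  have "is_inner_product Q"
    unfolding is_inner_product_def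
  proof (intro conjI allI impI)
    show "bilinear Q"
      unfolding bilinear_def Q_def N_def
      by (auto intro!: linearI simp: b lin algebra_simps diff_divide_distrib add_divide_distrib)
    show "Q y z = Q z y" for y z
      by (simp add: Q_def N_def b sym is_inner_product_commute[OF B, of y])
    show "0 < Q y y" if "y \<noteq> 0" for y
    proof -
      have "0 < B y y" using B that by (simp add: is_inner_product_def)
      then have "0 < (1 + \<delta>) * Q y y" using Qlow[of y] by linarith
      then show ?thesis using \<delta> by (simp add: zero_less_mult_iff)
    qed
  qed
  moreover have "0 \<le> m * (1 - \<delta>)" using m \<delta> by simp
  moreover have "m * (1 - \<delta>) \<le> L * (1 + \<delta>)" using m \<delta> by (intro mult_mono) auto
  moreover have "f z + Q (M (g z)) (y - z) + m * (1 - \<delta>) / 2 * Q (y - z) (y - z) \<le> f y" for y z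
    using lower[of z y] mult_left_mono[OF Qup[of "y - z"], of "m / 2"] m by (simp add: QM)
  moreover have "f y \<le> f z + Q (M (g z)) (y - z) + L * (1 + \<delta>) / 2 * Q (y - z) (y - z)" for y z
    using upper[of y z] mult_left_mono[OF Qlow[of "y - z"], of "L / 2"] m by (simp add: QM)
  moreover have "M (g s) = 0" by (simp add: M_def crit linear_0[OF R])
  ultimately have "f (x - h *\<^sub>R M (g x)) - f s \<le> (1 - h * (m * (1 - \<delta>)))\<^sup>2 * (f x - f s)"
    using h by (rule gradient_step_contraction)
  moreover have "M (g x) = d" by (simp add: M_def Rg v)
  ultimately show ?thesis by simp
qed

theorem theorem4p2:
  fixes B :: "real ^ 'n \<Rightarrow> real ^ 'n \<Rightarrow> real"
    and f :: "real ^ 'n \<Rightarrow> real"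
    and L \<mu> \<epsilon> hbar \<kappa> :: real
    and xstar x d :: "real ^ 'n"
  assumes "is_inner_product B"
    and "0 < \<mu>" and "\<mu> \<le> L"
    and "L_smooth B L f"
    and "strongly_convex B \<mu> f"
    and "is_arg_min f (\<lambda>_. True) xstar"
    and "ip_gradient B f x \<noteq> 0"
    and "0 \<le> \<epsilon>" and "\<epsilon> < 1"
    and "ip_norm B (d - ip_gradient B f x) \<le> \<epsilon> * ip_norm B (ip_gradient B f x)"
    and "hbar = 2 / (L * (1 + \<epsilon>) + \<mu> * (1 - \<epsilon>))"
    and "\<kappa> = L / \<mu> * ((1 + \<epsilon>) / (1 - \<epsilon>))"
  shows "(\<forall>h. 0 \<le> h \<and> h \<le> hbar \<longrightarrow>
            f (x - h *\<^sub>R d) - f xstar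
              \<le> (1 - h * \<mu> * (1 - ip_norm B (d - ip_gradient B f x) / ip_norm B (ip_gradient B f x)))\<^sup>2
                 * (f x - f xstar) \<and>
            (1 - h * \<mu> * (1 - ip_norm B (d - ip_gradient B f x) / ip_norm B (ip_gradient B f x)))\<^sup>2
                 * (f x - f xstar)
              \<le> (1 - h * \<mu> * (1 - \<epsilon>))\<^sup>2 * (f x - f xstar)) \<and>
         f (x - hbar *\<^sub>R d) - f xstar
           \<le> ((\<kappa> - 1) / (\<kappa> + 1))\<^sup>2 * (f x - f xstar)"
proof -
  note B = assms(1) and mu = assms(2) and muL = assms(3) and eps = assms(8,9)
  define g where "g = ip_gradient B f"
  define \<delta> where "\<delta> = ip_norm B (d - g x) / ip_norm B (g x)"
  have gx: "0 < ip_norm B (g x)"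
    using assms(7) by (simp add: g_def ip_norm_pos[OF B])
  have \<delta>0: "0 \<le> \<delta>" using gx ip_norm_nonneg[OF B] by (simp add: \<delta>_def)
  have \<delta>\<epsilon>: "\<delta> \<le> \<epsilon>" using assms(10) gx by (simp add: \<delta>_def g_def field_simps)
  have err: "ip_norm B (d - g x) = \<delta> * ip_norm B (g x)" using gx by (simp add: \<delta>_def)
  have L: "0 < L" using mu muL by simp
  have min: "f xstar \<le> f y" for y
    using assms(6) by (auto simp: is_arg_min_def not_less)
  have crit: "g xstar = 0"
    unfolding g_def using assms(4) min
    by (intro ip_gradient_eq_0_at_minimum[OF B]) (auto simp: L_smooth_def)
  have lower: "f z + B (g z) (y - z) + \<mu> / 2 * B (y - z) (y - z) \<le> f y" for y z
    using assms(5) by (simp add: strongly_convex_def g_def ip_norm_square[OF B])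
  have upper: "f y \<le> f z + B (g z) (y - z) + L / 2 * B (y - z) (y - z)" for y z
    unfolding g_def by (rule L_smooth_quadratic_upper_bound[OF B L assms(4)])
  define den where "den = L * (1 + \<epsilon>) + \<mu> * (1 - \<epsilon>)"
  have mono: "L * (1 + t) + \<mu> * (1 - t) \<le> den" if "t \<le> \<epsilon>" for t
  proof -
    have "t * (L - \<mu>) \<le> \<epsilon> * (L - \<mu>)" using that muL by (intro mult_right_mono) auto
    then show ?thesis by (simp add: den_def algebra_simps)
  qed
  \<comment> \<open>Hence \<open>h \<mu> \<le> 1\<close> for every admissible \<open>h\<close>, which keeps the contraction factors nonnegative,
    so that they may be compared before squaring.\<close>
  have den2: "2 * \<mu> \<le> den" using mono[of 0] eps muL by simp
  then have den0: "0 < den" using mu by simp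
  have main: "f (x - h *\<^sub>R d) - f xstar \<le> (1 - h * \<mu> * (1 - \<delta>))\<^sup>2 * (f x - f xstar)"
    and weaken: "(1 - h * \<mu> * (1 - \<delta>))\<^sup>2 * (f x - f xstar)
       \<le> (1 - h * \<mu> * (1 - \<epsilon>))\<^sup>2 * (f x - f xstar)"
    if h: "0 \<le> h" "h \<le> hbar" for h
  proof -
    have hden: "h * den \<le> 2"
      using h(2) den0 by (simp add: assms(11) den_def[symmetric] pos_le_divide_eq)
    have "h * (L * (1 + \<delta>) + \<mu> * (1 - \<delta>)) \<le> h * den"
      using mono[OF \<delta>\<epsilon>] h(1) by (rule mult_left_mono)
    then have step: "h * (L * (1 + \<delta>) + \<mu> * (1 - \<delta>)) \<le> 2" using hden by simp
    have "\<delta> < 1" using \<delta>\<epsilon> eps by simp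
    from inexact_gradient_step_contraction[where B = B and f = f and g = g,
        OF B less_imp_le[OF mu] muL lower upper crit \<delta>0 this err h(1) step]
    show "f (x - h *\<^sub>R d) - f xstar \<le> (1 - h * \<mu> * (1 - \<delta>))\<^sup>2 * (f x - f xstar)"
      by (simp add: mult.assoc)
    have "h * (2 * \<mu>) \<le> h * den" using den2 h(1) by (rule mult_left_mono)
    then have "h * \<mu> \<le> 1" using hden by simp
    moreover have "h * \<mu> * (1 - \<delta>) \<le> h * \<mu>"
      using \<delta>0 h(1) mu by (simp add: mult_left_le)
    ultimately have "0 \<le> 1 - h * \<mu> * (1 - \<delta>)" by simp
    moreover have "h * \<mu> * (1 - \<epsilon>) \<le> h * \<mu> * (1 - \<delta>)"
      using \<delta>\<epsilon> h(1) mu by (intro mult_left_mono) auto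
    ultimately show "(1 - h * \<mu> * (1 - \<delta>))\<^sup>2 * (f x - f xstar)
       \<le> (1 - h * \<mu> * (1 - \<epsilon>))\<^sup>2 * (f x - f xstar)"
      using min by (intro mult_right_mono power_mono) auto
  qed
  have "1 - hbar * \<mu> * (1 - \<epsilon>) = (\<kappa> - 1) / (\<kappa> + 1)"
  proof -
    have k: "\<kappa> = L * (1 + \<epsilon>) / (\<mu> * (1 - \<epsilon>))" and pos: "0 < \<mu> * (1 - \<epsilon>)"
      using assms(12) mu eps by simp_all
    have quotient: "(a / e - 1) / (a / e + 1) = (a - e) / (a + e)" if "0 < e" for a e :: real
    proof -
      have "a / e - 1 = (a - e) / e" "a / e + 1 = (a + e) / e"
        using that by (simp_all add: field_simps)
      then show ?thesis using that by simp
    qed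
    have "(\<kappa> - 1) / (\<kappa> + 1) = (L * (1 + \<epsilon>) - \<mu> * (1 - \<epsilon>)) / den"
      unfolding k den_def by (rule quotient[OF pos])
    also have "\<dots> = 1 - hbar * \<mu> * (1 - \<epsilon>)"
      using den0 by (simp add: assms(11) den_def[symmetric] diff_divide_eq_iff)
        (simp add: den_def algebra_simps)
    finally show ?thesis by simp
  qed
  moreover have "0 \<le> hbar" using den0 assms(11) by (simp add: den_def)
  ultimately have "f (x - hbar *\<^sub>R d) - f xstar
      \<le> ((\<kappa> - 1) / (\<kappa> + 1))\<^sup>2 * (f x - f xstar)"
    using order_trans[OF main[of hbar] weaken[of hbar]] by simp
  then show ?thesis
    using main weaken unfolding \<delta>_def g_def by blast
qed

end
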